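(* Let $1<p<\infty$. There is a constant $C>0$ depending only on $p$ such that for every nonnegative sequence $a=\{a(n)\}_{n\in\mathbb{Z}}$ in $\ell^p(\mathbb{Z})$, $$\sum_{m\in\mathbb{Z}}|M_d a(m)|^p\ \le\ C\sum_{m\in\mathbb{Z}}|M^{\#}a(m)|^p$$ whenever the left-hand side is finite, where $M_d$ is the dyadic Hardy-Littlewood maximal operator and $M^{\#}$ is the sharp maximal operator.
   Context: An interval in $\mathbb{Z}$ is a finite nonempty set of consecutive integers; $|I|$ denotes its cardinality. The dyadic intervals in $\mathbb{Z}$ are the sets $I_{N,j}=\{(j-1)2^N+1,\dots,j2^N\}$ with $N$ a positive integer ($N\ge 1$) and $j\in\mathbb{Z}$. For a real sequence $a$ and $m\in\mathbb{Z}$ define: Dyadic Hardy-Littlewood maximal operator: $M_d a(m)=\sup_{I\ni m}\frac{1}{|I|}\sum_{k\in I}|a(k)|$, the supremum being over all dyadic intervals $I$ containing $m$. Sharp maximal operator: $M^{\#}a(m)=\sup_{I\ni m}\frac{1}{|I|}\sum_{n\in I}|a(n)-a_I|$, the supremum being over all intervals $I$ in $\mathbb{Z}$ containing $m$, where $a_I=\frac{1}{|I|}\sum_{k\in I}a(k)$. *)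

theory Defs
  imports "HOL-Analysis.Analysis"
begin

definition intervals :: "int set set" where
  "intervals = {{i..j} | i j. i \<le> j}"

definition dyadic_interval :: "nat \<Rightarrow> int \<Rightarrow> int set" where
  "dyadic_interval N j = {(j - 1) * 2 ^ N + 1 .. j * 2 ^ N}"

definition dyadic_intervals :: "int set set" where
  "dyadic_intervals = {dyadic_interval N j | N j. N \<ge> 1}"

definition avg :: "(int \<Rightarrow> real) \<Rightarrow> int set \<Rightarrow> real" where
  "avg a I = (\<Sum>k\<in>I. a k) / real (card I)"

text \<open>The two suprema below are taken in the reals, so they are meaningful only for sequences
  for which the averages are bounded above. This holds for all sequences in \<open>\<ell>\<^sup>p\<close>
  with \<open>p > 0\<close>; see \<open>bdd_above_dyadic\<close> and \<open>bdd_above_sharp\<close>.\<close>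

definition dyadic_maximal :: "(int \<Rightarrow> real) \<Rightarrow> int \<Rightarrow> real" where
  "dyadic_maximal a m =
     (SUP I\<in>{I \<in> dyadic_intervals. m \<in> I}. (\<Sum>k\<in>I. \<bar>a k\<bar>) / real (card I))"

definition sharp_maximal :: "(int \<Rightarrow> real) \<Rightarrow> int \<Rightarrow> real" where
  "sharp_maximal a m =
     (SUP I\<in>{I \<in> intervals. m \<in> I}. (\<Sum>n\<in>I. \<bar>a n - avg a I\<bar>) / real (card I))"

definition in_lp :: "real \<Rightarrow> (int \<Rightarrow> real) \<Rightarrow> bool" where
  "in_lp p a \<longleftrightarrow> (\<lambda>n. \<bar>a n\<bar> powr p) summable_on UNIV"

lemma in_lp_bounded:
  assumes "p > 0" "in_lp p a"
  obtains B where "\<And>n. \<bar>a n\<bar> \<le> B"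
proof -
  define S where "S = (\<Sum>\<^sub>\<infinity>n. \<bar>a n\<bar> powr p)"
  have "\<bar>a n\<bar> \<le> S powr (1 / p)" for n
  proof -
    have "(\<Sum>k\<in>{n}. \<bar>a k\<bar> powr p) \<le> S"
      unfolding S_def using assms(2) unfolding in_lp_def
      by (intro finite_sum_le_infsum) auto
    then have "(\<bar>a n\<bar> powr p) powr (1 / p) \<le> S powr (1 / p)"
      using assms(1) by (intro powr_mono2) auto
    then show ?thesis
      using assms(1) by (simp add: powr_powr)
  qed
  then show ?thesis using that by blast
qed

lemma mean_le:
  fixes f :: "int \<Rightarrow> real"
  assumes "\<And>k. f k \<le> B" "B \<ge> 0"
  shows "(\<Sum>k\<in>I. f k) / real (card I) \<le> B"
proof (cases "card I = 0")
  case False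
  have "(\<Sum>k\<in>I. f k) \<le> real (card I) * B"
    using assms(1) by (rule sum_bounded_above)
  then show ?thesis using False by (simp add: divide_le_eq mult.commute)
qed (use assms in auto)

lemma bdd_above_dyadic:
  assumes "p > 0" "in_lp p a"
  shows "bdd_above ((\<lambda>I. (\<Sum>k\<in>I. \<bar>a k\<bar>) / real (card I)) ` {I \<in> dyadic_intervals. m \<in> I})"
proof -
  obtain B where B: "\<And>n. \<bar>a n\<bar> \<le> B" using in_lp_bounded[OF assms] by blast
  moreover have "B \<ge> 0" using B[of 0] by linarith
  ultimately show ?thesis by (intro bdd_aboveI2[where M = B] mean_le) auto
qed

lemma bdd_above_sharp:
  assumes "p > 0" "in_lp p a"
  shows "bdd_above ((\<lambda>I. (\<Sum>n\<in>I. \<bar>a n - avg a I\<bar>) / real (card I)) ` {I \<in> intervals. m \<in> I})"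
proof -
  obtain B where B: "\<And>n. \<bar>a n\<bar> \<le> B" using in_lp_bounded[OF assms] by blast
  have B0: "B \<ge> 0" using B[of 0] by linarith
  have avg_le: "\<bar>avg a I\<bar> \<le> B" for I
  proof -
    have "\<bar>avg a I\<bar> \<le> (\<Sum>k\<in>I. \<bar>a k\<bar>) / real (card I)"
      unfolding avg_def by (simp add: divide_right_mono sum_abs)
    also have "\<dots> \<le> B" using B B0 by (rule mean_le)
    finally show ?thesis .
  qed
  have "\<bar>a n - avg a I\<bar> \<le> 2 * B" for n I
    using B[of n] avg_le[of I] by linarith
  then show ?thesis using B0 by (intro bdd_aboveI2[where M = "2 * B"] mean_le) auto
qed

end

theory Submission
  imports Defs
begin

text \<open>A good-\<open>\<lambda>\<close> argument. The level set \<open>{M\<^sub>d a > t}\<close> is finite, hence a disjoint union of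
  maximal dyadic intervals \<open>Q\<close> on which \<open>a\<close> has mean exceeding \<open>t\<close>, while the mean over the dyadic
  parent of \<open>Q\<close> is at most \<open>t\<close>. Where \<open>M\<^sub>d a > 2 * t\<close> inside \<open>Q\<close>, the excess is therefore
  oscillation of \<open>a\<close> over the parent, which the sharp maximal function at any point of \<open>Q\<close> controls.
  Thus at most the fraction \<open>2 * \<gamma>\<close> of \<open>{M\<^sub>d a > t}\<close> satisfies both \<open>M\<^sub>d a > 2 * t\<close> and
  \<open>M\<^sup># a \<le> \<gamma> * t\<close>. Summing over \<open>t = 2\<^sup>k\<close> with weights \<open>2\<^sup>k\<^sup>p\<close>, the term with \<open>2 * \<gamma>\<close> is
  absorbed into the left-hand side for small \<open>\<gamma>\<close>, because the left-hand side is finite.\<close>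

section \<open>Sums over the integers as integrals, and the discrete layer-cake formula\<close>

lemma infsum_int_ennreal_eq_nn_integral:
  fixes f :: "int \<Rightarrow> ennreal"
  shows "(\<Sum>\<^sub>\<infinity>m\<in>UNIV. f m) = (\<integral>\<^sup>+m. f m \<partial>count_space UNIV)"
proof -
  have bij: "bij_betw int_decode UNIV (UNIV :: int set)"
    by (rule bij_int_decode)
  have "((\<lambda>n. f (int_decode n)) has_sum (\<Sum>\<^sub>\<infinity>n. f (int_decode n))) UNIV"
    by (intro has_sum_infsum nonneg_summable_on_complete) auto
  then have "(\<Sum>\<^sub>\<infinity>n. f (int_decode n)) = (\<Sum>n. f (int_decode n))"
    by (intro sums_unique has_sum_imp_sums)
  also have "\<dots> = (\<integral>\<^sup>+m. f m \<partial>count_space UNIV)"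
    by (simp add: nn_integral_count_space_nat[symmetric] nn_integral_bij_count_space[OF bij])
  finally show ?thesis
    by (simp add: infsum_reindex_bij_betw[OF bij])
qed

text \<open>A discrete layer-cake substitute for \<open>x powr p\<close>: for positive
  \<open>p\<close> and nonnegative \<open>x\<close> the two agree up to factors depending only on
  \<open>p\<close>. The sum over levels is an integral for counting measure so that it can be
  exchanged with an integral over \<open>x\<close>.\<close>

definition dyadic_layers :: "real \<Rightarrow> real \<Rightarrow> ennreal" where
  "dyadic_layers p x =
     (\<integral>\<^sup>+k. ennreal (2 powr (p * of_int k)) * indicator {k. 2 powr of_int k < x} k
        \<partial>count_space (UNIV :: int set))"

lemma dyadic_scale:
  fixes x :: real
  assumes "x > 0"
  obtains k :: int where "2 powr of_int k < x" "x \<le> 2 powr (of_int k + 1)"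
    and "\<And>j :: int. 2 powr of_int j < x \<Longrightarrow> j \<le> k"
proof
  \<comment> \<open>Ceiling minus one rather than floor: when \<open>x\<close> is itself a power of
    two, the strict inequality excludes that power.\<close>
  let ?k = "\<lceil>log 2 x\<rceil> - 1"
  have iff: "2 powr of_int j < x \<longleftrightarrow> of_int j < log 2 x" for j :: int
    using assms by (simp add: less_log_iff)
  show "2 powr of_int ?k < x"
    unfolding iff by linarith
  have "x = 2 powr log 2 x"
    using assms by simp
  also have "\<dots> \<le> 2 powr (of_int ?k + 1)"
    by (intro powr_mono) auto
  finally show "x \<le> 2 powr (of_int ?k + 1)" .
  show "j \<le> ?k" if "2 powr of_int j < x" for j :: int
    using that unfolding iff by linarith
qed

text \<open>The top level below \<open>x\<close> suffices: it is within a factor 2 of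
  \<open>x\<close>, which costs \<open>2 powr p\<close>.\<close>

lemma powr_le_dyadic_layers:
  fixes p x :: real
  assumes "p > 0" "x \<ge> 0"
  shows "ennreal (x powr p) \<le> ennreal (2 powr p) * dyadic_layers p x"
proof (cases "x = 0")
  case False
  with assms have "x > 0" by simp
  then obtain k :: int where k: "2 powr of_int k < x" "x \<le> 2 powr (of_int k + 1)"
    using dyadic_scale by blast
  have "ennreal (2 powr (p * of_int k)) =
      (\<integral>\<^sup>+j. ennreal (2 powr (p * of_int j)) * indicator {k} j \<partial>count_space UNIV)"
    by simp
  also have "\<dots> \<le> dyadic_layers p x"
    unfolding dyadic_layers_def using k(1)
    by (intro nn_integral_mono) (auto split: split_indicator)
  finally have "ennreal (2 powr (p * of_int k)) \<le> dyadic_layers p x" .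
  have "x powr p \<le> (2 powr (of_int k + 1)) powr p"
    using k(2) assms by (intro powr_mono2) auto
  also have "\<dots> = 2 powr p * 2 powr (p * of_int k)"
    by (simp add: powr_powr powr_add[symmetric] algebra_simps)
  finally have "ennreal (x powr p) \<le> ennreal (2 powr p) * ennreal (2 powr (p * of_int k))"
    by (simp add: ennreal_mult[symmetric])
  also have "\<dots> \<le> ennreal (2 powr p) * dyadic_layers p x"
    by (intro mult_left_mono) (fact, simp)
  finally show ?thesis .
qed simp

text \<open>Counted downwards from the top level, the weights form a geometric series of ratio
  \<open>2 powr (- p)\<close>, less than 1 because \<open>p\<close> is positive.\<close>

lemma dyadic_layers_le_powr:
  fixes p x :: real
  assumes "p > 0" "x \<ge> 0"
  shows "dyadic_layers p x \<le> ennreal (1 / (1 - 2 powr (- p))) * ennreal (x powr p)"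
proof (cases "x = 0")
  case True
  then have "{k :: int. 2 powr of_int k < x} = {}"
    using powr_ge_zero[of 2] by (auto simp: not_less)
  then show ?thesis
    by (simp add: dyadic_layers_def)
next
  case False
  with assms have "x > 0" by simp
  then obtain k :: int where k: "2 powr of_int k < x"
    and le_k: "\<And>j :: int. 2 powr of_int j < x \<Longrightarrow> j \<le> k"
    using dyadic_scale by blast
  have r: "0 \<le> 2 powr (- p)" "2 powr (- p) < 1"
    using assms powr_less_mono[of "- p" 0 2] by auto
  have bij: "bij_betw (\<lambda>n. k - int n) UNIV {..k}"
    by (rule bij_betw_byWitness[where f' = "\<lambda>j. nat (k - j)"]) auto
  have eq: "2 powr (p * of_int (k - int n)) = 2 powr (p * of_int k) * (2 powr (- p)) ^ n" for n
    by (simp add: powr_realpow[symmetric] powr_powr powr_add[symmetric] algebra_simps)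
  have sums: "(\<lambda>n. 2 powr (p * of_int (k - int n))) sums
      (2 powr (p * of_int k) * (1 / (1 - 2 powr (- p))))"
    unfolding eq using r by (intro sums_mult geometric_sums) auto
  have "dyadic_layers p x \<le>
      (\<integral>\<^sup>+j. ennreal (2 powr (p * of_int j)) * indicator {..k} j \<partial>count_space UNIV)"
    unfolding dyadic_layers_def using le_k
    by (intro nn_integral_mono) (auto split: split_indicator)
  also have "\<dots> = (\<integral>\<^sup>+j. ennreal (2 powr (p * of_int j)) \<partial>count_space {..k})"
    by (simp add: nn_integral_count_space_indicator)
  also have "\<dots> = (\<Sum>n. ennreal (2 powr (p * of_int (k - int n))))"
    by (simp add: nn_integral_bij_count_space[OF bij, symmetric] nn_integral_count_space_nat)
  also have "\<dots> = ennreal (2 powr (p * of_int k) * (1 / (1 - 2 powr (- p))))"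
    using sums by (intro suminf_ennreal_eq) auto
  also have "\<dots> \<le> ennreal (1 / (1 - 2 powr (- p)) * x powr p)"
  proof -
    have "2 powr (p * of_int k) = (2 powr of_int k) powr p"
      by (simp add: powr_powr mult.commute)
    also have "\<dots> \<le> x powr p"
      using k assms by (intro powr_mono2) auto
    finally show ?thesis
      using r by (intro ennreal_leI) (simp add: divide_right_mono)
  qed
  also have "\<dots> = ennreal (1 / (1 - 2 powr (- p))) * ennreal (x powr p)"
    using r by (intro ennreal_mult) auto
  finally show ?thesis .
qed

section \<open>Integration of the layers and the abstract good-\<lambda> inequality\<close>

lemma borel_measurable_dyadic_layers [measurable]: "dyadic_layers p \<in> borel_measurable borel"
proof -
  have "dyadic_layers p = (\<lambda>x. \<Sum>n. ennreal (2 powr (p * of_int (int_decode n))) *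
      indicator {2 powr of_int (int_decode n) <..} x)"
    unfolding dyadic_layers_def
    by (subst nn_integral_bij_count_space[OF bij_int_decode, symmetric])
      (simp add: nn_integral_count_space_nat indicator_def)
  then show ?thesis by simp
qed

text \<open>Exchanging the integral with the countable sum over levels turns each layer into the
  measure of a superlevel set, the quantity that a good-\<lambda> estimate bounds.\<close>

lemma nn_integral_dyadic_layers:
  assumes [measurable]: "f \<in> borel_measurable M"
  shows "(\<integral>\<^sup>+x. dyadic_layers p (f x) \<partial>M) =
    (\<integral>\<^sup>+k. ennreal (2 powr (p * of_int k)) * emeasure M {x \<in> space M. 2 powr of_int k < f x}
       \<partial>count_space UNIV)"
proof -
  have "(\<integral>\<^sup>+x. dyadic_layers p (f x) \<partial>M) =
      (\<integral>\<^sup>+x. \<integral>\<^sup>+k. ennreal (2 powr (p * of_int k)) *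
         indicator {x \<in> space M. 2 powr of_int k < f x} x \<partial>count_space UNIV \<partial>M)"
    unfolding dyadic_layers_def
    by (intro nn_integral_cong) (auto split: split_indicator)
  also have "\<dots> = (\<integral>\<^sup>+k. \<integral>\<^sup>+x. ennreal (2 powr (p * of_int k)) *
         indicator {x \<in> space M. 2 powr of_int k < f x} x \<partial>M \<partial>count_space UNIV)"
    by (intro nn_integral_count_space_nn_integral) auto
  also have "\<dots> = (\<integral>\<^sup>+k. ennreal (2 powr (p * of_int k)) *
       emeasure M {x \<in> space M. 2 powr of_int k < f x} \<partial>count_space UNIV)"
    by (intro nn_integral_cong nn_integral_cmult_indicator) auto
  finally show ?thesis .
qed

text \<open>The absorption is carried out on the layer sum \<open>T\<close> of \<open>f\<close>, to
  which the hypothesis at \<open>t = 2 powr of_int k\<close> applies level by level. The two layer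
  comparisons then translate back to p-th powers.\<close>

lemma nn_integral_good_lambda:
  fixes f g :: "'a \<Rightarrow> real" and p \<gamma> \<epsilon> :: real
  assumes [measurable]: "f \<in> borel_measurable M" "g \<in> borel_measurable M"
    and nonneg: "\<And>x. f x \<ge> 0" "\<And>x. g x \<ge> 0"
    and p: "p > 0" and \<gamma>: "\<gamma> > 0" and \<epsilon>: "\<epsilon> \<ge> 0" "2 powr p * \<epsilon> \<le> 1 / 2"
    and good: "\<And>t. t > 0 \<Longrightarrow> emeasure M {x \<in> space M. 2 * t < f x} \<le>
      ennreal \<epsilon> * emeasure M {x \<in> space M. t < f x} + emeasure M {x \<in> space M. \<gamma> * t < g x}"
    and finite: "(\<integral>\<^sup>+x. ennreal (f x powr p) \<partial>M) < \<infinity>"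
  shows "(\<integral>\<^sup>+x. ennreal (f x powr p) \<partial>M) \<le>
    ennreal (2 powr p * (2 * 2 powr p * (1 / (1 - 2 powr (- p)) * (1 / \<gamma>) powr p))) *
      (\<integral>\<^sup>+x. ennreal (g x powr p) \<partial>M)"
proof -
  define c where "c = 1 / (1 - 2 powr (- p))"
  define F where "F k = emeasure M {x \<in> space M. 2 powr of_int k < f x}" for k :: int
  \<comment> \<open>Dividing by \<gamma> makes these superlevel sets at powers of two again, so the
    layer lemmas apply to \<open>g x / \<gamma>\<close>.\<close>
  define G where "G k = emeasure M {x \<in> space M. 2 powr of_int k < g x / \<gamma>}" for k :: int
  define w where "w k = ennreal (2 powr (p * of_int k))" for k :: int
  define T where "T = (\<integral>\<^sup>+k. w k * F k \<partial>count_space UNIV)"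
  define R where "R = (\<integral>\<^sup>+k. w k * G k \<partial>count_space UNIV)"
  have c: "c > 0"
    using p powr_less_mono[of "- p" 0 2] by (simp add: c_def)
  have T_eq: "T = (\<integral>\<^sup>+x. dyadic_layers p (f x) \<partial>M)"
    unfolding T_def w_def F_def by (rule nn_integral_dyadic_layers[symmetric]) simp
  have R_eq: "R = (\<integral>\<^sup>+x. dyadic_layers p (g x / \<gamma>) \<partial>M)"
    unfolding R_def w_def G_def by (rule nn_integral_dyadic_layers[symmetric]) simp
  \<comment> \<open>Finiteness passes from the integral to \<open>T\<close>; it is what later
    permits subtracting half of \<open>T\<close> from both sides.\<close>
  have "T \<le> (\<integral>\<^sup>+x. ennreal c * ennreal (f x powr p) \<partial>M)"
    unfolding T_eq using p nonneg by (intro nn_integral_mono dyadic_layers_le_powr[of p, folded c_def]) auto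
  also have "\<dots> = ennreal c * (\<integral>\<^sup>+x. ennreal (f x powr p) \<partial>M)"
    by (intro nn_integral_cmult) simp
  also have "\<dots> < \<infinity>"
    using finite by (simp add: ennreal_mult_less_top)
  finally have T_fin: "T < \<infinity>" .
  have "R \<le> (\<integral>\<^sup>+x. ennreal (c * (1 / \<gamma>) powr p) * ennreal (g x powr p) \<partial>M)"
    unfolding R_eq
  proof (intro nn_integral_mono)
    fix x
    have "dyadic_layers p (g x / \<gamma>) \<le> ennreal c * ennreal ((g x / \<gamma>) powr p)"
      using p \<gamma> nonneg by (intro dyadic_layers_le_powr[of p, folded c_def]) auto
    also have "(g x / \<gamma>) powr p = (1 / \<gamma>) powr p * g x powr p"
      using \<gamma> nonneg(2)[of x] by (simp add: powr_divide)
    finally show "dyadic_layers p (g x / \<gamma>) \<le>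
        ennreal (c * (1 / \<gamma>) powr p) * ennreal (g x powr p)"
      using c by (simp add: ennreal_mult mult.assoc)
  qed
  also have "\<dots> = ennreal (c * (1 / \<gamma>) powr p) * (\<integral>\<^sup>+x. ennreal (g x powr p) \<partial>M)"
    by (intro nn_integral_cmult) simp
  finally have R_le: "R \<le> ennreal (c * (1 / \<gamma>) powr p) * (\<integral>\<^sup>+x. ennreal (g x powr p) \<partial>M)" .
  have step: "w (k + 1) * F (k + 1) \<le>
      ennreal (1 / 2) * (w k * F k) + ennreal (2 powr p) * (w k * G k)" for k
  proof -
    have w: "w (k + 1) = ennreal (2 powr p) * w k"
      by (simp add: w_def ennreal_mult[symmetric] powr_add[symmetric] algebra_simps)
    have G: "emeasure M {x \<in> space M. \<gamma> * 2 powr of_int k < g x} = G k"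
      unfolding G_def using \<gamma> by (simp add: pos_less_divide_eq mult.commute)
    have "F (k + 1) = emeasure M {x \<in> space M. 2 * 2 powr of_int k < f x}"
      by (simp add: F_def powr_add mult.commute)
    also have "\<dots> \<le> ennreal \<epsilon> * F k + G k"
      using good[of "2 powr of_int k"] unfolding G by (simp add: F_def)
    finally have "w (k + 1) * F (k + 1) \<le> w (k + 1) * (ennreal \<epsilon> * F k + G k)"
      by (rule mult_left_mono) simp
    also have "\<dots> = (ennreal (2 powr p) * ennreal \<epsilon>) * (w k * F k) + ennreal (2 powr p) * (w k * G k)"
      unfolding w by (simp add: algebra_simps)
    \<comment> \<open>Moving up one level multiplies the weight by \<open>2 powr p\<close>; the
      smallness of \<epsilon> compensates and leaves the factor 1/2.\<close>
    also have "\<dots> \<le> ennreal (1 / 2) * (w k * F k) + ennreal (2 powr p) * (w k * G k)"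
    proof (intro add_right_mono mult_right_mono)
      show "ennreal (2 powr p) * ennreal \<epsilon> \<le> ennreal (1 / 2)"
        unfolding ennreal_mult[OF powr_ge_zero \<epsilon>(1), symmetric] by (rule ennreal_leI[OF \<epsilon>(2)])
    qed simp
    finally show ?thesis .
  qed
  \<comment> \<open>A sum over all integer levels is invariant under a shift, so the left sides of
    \<open>step\<close> add up to \<open>T\<close> with no boundary term.\<close>
  have bij: "bij (\<lambda>k :: int. k + 1)"
    by (rule bij_betw_byWitness[where f' = "\<lambda>k. k - 1"]) auto
  have "T = (\<integral>\<^sup>+k. w (k + 1) * F (k + 1) \<partial>count_space UNIV)"
    unfolding T_def using nn_integral_bij_count_space[OF bij, of "\<lambda>k. w k * F k"] by simp
  also have "\<dots> \<le> (\<integral>\<^sup>+k. ennreal (1 / 2) * (w k * F k) + ennreal (2 powr p) * (w k * G k)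
      \<partial>count_space UNIV)"
    by (intro nn_integral_mono step)
  also have "\<dots> = ennreal (1 / 2) * T + ennreal (2 powr p) * R"
    unfolding T_def R_def by (simp add: nn_integral_add nn_integral_cmult)
  finally have T_le: "T \<le> ennreal (1 / 2) * T + ennreal (2 powr p) * R" .
  \<comment> \<open>For infinite \<open>R\<close> nothing is to be shown; otherwise both sums are
    real numbers and the cancellation is done there.\<close>
  have "T \<le> ennreal (2 * 2 powr p) * R"
  proof (cases "R = \<infinity>")
    case True
    then show ?thesis by (simp add: ennreal_mult_top)
  next
    case False
    then obtain r where r: "R = ennreal r" "r \<ge> 0" by (cases R) auto
    obtain t where t: "T = ennreal t" "t \<ge> 0" using T_fin by (cases T) auto
    have "ennreal (1 / 2) * ennreal t + ennreal (2 powr p) * ennreal r =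
        ennreal (1 / 2 * t + 2 powr p * r)"
      using r(2) t(2) by (subst (1 2) ennreal_mult[symmetric]) (auto intro!: ennreal_plus[symmetric])
    then have "ennreal t \<le> ennreal (1 / 2 * t + 2 powr p * r)"
      using T_le unfolding r(1) t(1) by metis
    then have "t \<le> 1 / 2 * t + 2 powr p * r"
      using r t by (subst (asm) ennreal_le_iff) auto
    then show ?thesis
      using r t by (simp add: ennreal_mult[symmetric] ennreal_leI)
  qed
  have "(\<integral>\<^sup>+x. ennreal (f x powr p) \<partial>M) \<le>
      (\<integral>\<^sup>+x. ennreal (2 powr p) * dyadic_layers p (f x) \<partial>M)"
    using p nonneg by (intro nn_integral_mono powr_le_dyadic_layers)
  also have "\<dots> = ennreal (2 powr p) * T"
  proof -
    show ?thesis unfolding T_eq by (rule nn_integral_cmult) measurable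
  qed
  also have "\<dots> \<le> ennreal (2 powr p) * (ennreal (2 * 2 powr p) *
      (ennreal (c * (1 / \<gamma>) powr p) * (\<integral>\<^sup>+x. ennreal (g x powr p) \<partial>M)))"
    using \<open>T \<le> ennreal (2 * 2 powr p) * R\<close> R_le
    by (meson mult_left_mono order_trans zero_le)
  also have "\<dots> = ennreal (2 powr p * (2 * 2 powr p * (c * (1 / \<gamma>) powr p))) *
      (\<integral>\<^sup>+x. ennreal (g x powr p) \<partial>M)"
    using c by (simp add: ennreal_mult mult.assoc)
  finally show ?thesis unfolding c_def .
qed

section \<open>Dyadic intervals: nesting, covering and parents\<close>

lemma mem_dyadic_interval_iff: "m \<in> dyadic_interval N j \<longleftrightarrow> (m - 1) div 2 ^ N = j - 1"
proof
  assume "m \<in> dyadic_interval N j"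
  then show "(m - 1) div 2 ^ N = j - 1"
    \<comment> \<open>Blocks begin one after a multiple of \<open>2 ^ N\<close>, so it is
      \<open>m - 1\<close> that has a remainder between 0 and \<open>2 ^ N - 1\<close>.\<close>
    by (intro int_div_pos_eq[where r = "m - 1 - (j - 1) * 2 ^ N"])
      (auto simp: dyadic_interval_def algebra_simps)
next
  assume "(m - 1) div 2 ^ N = j - 1"
  then have "m - 1 = (j - 1) * 2 ^ N + (m - 1) mod 2 ^ N"
    by (metis div_mult_mod_eq)
  then have "m = (j - 1) * 2 ^ N + (m - 1) mod 2 ^ N + 1"
    by linarith
  moreover have "0 \<le> (m - 1) mod 2 ^ N" "(m - 1) mod 2 ^ N < 2 ^ N"
    by simp_all
  ultimately show "m \<in> dyadic_interval N j"
    unfolding dyadic_interval_def atLeastAtMost_iff left_diff_distrib by linarith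
qed

lemma card_dyadic_interval: "card (dyadic_interval N j) = 2 ^ N"
  by (simp add: dyadic_interval_def algebra_simps nat_power_eq)

text \<open>The quotient by \<open>2 ^ K\<close> is determined by the quotient by
  \<open>2 ^ N\<close>, so points sharing a fine block share the coarse one.\<close>

lemma dyadic_interval_mono:
  assumes "x \<in> dyadic_interval N i" "x \<in> dyadic_interval K j" "N \<le> K"
  shows "dyadic_interval N i \<subseteq> dyadic_interval K j"
proof
  fix y
  assume y: "y \<in> dyadic_interval N i"
  have "(z - 1) div 2 ^ K = (z - 1) div 2 ^ N div 2 ^ (K - N)" for z :: int
    using assms(3) by (simp add: zdiv_zmult2_eq[symmetric] power_add[symmetric])
  then show "y \<in> dyadic_interval K j"
    using assms(1,2) y by (simp add: mem_dyadic_interval_iff)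
qed

lemma dyadic_intervals_laminar:
  assumes "I \<in> dyadic_intervals" "J \<in> dyadic_intervals" "x \<in> I" "x \<in> J"
  shows "I \<subseteq> J \<or> J \<subseteq> I"
proof -
  obtain N i K j where "I = dyadic_interval N i" "J = dyadic_interval K j"
    using assms(1,2) by (auto simp: dyadic_intervals_def)
  then show ?thesis
    using assms(3,4) dyadic_interval_mono[of x N i K j] dyadic_interval_mono[of x K j N i]
    by (cases "N \<le> K") auto
qed

lemma dyadic_intervals_cover: "\<exists>I\<in>dyadic_intervals. m \<in> I"
proof
  show "m \<in> dyadic_interval 1 ((m - 1) div 2 + 1)"
    by (simp add: mem_dyadic_interval_iff)
qed (auto simp: dyadic_intervals_def)

lemma dyadic_parent:
  assumes "I \<in> dyadic_intervals"
  obtains J where "J \<in> dyadic_intervals" "I \<subset> J" "card J = 2 * card I"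
proof -
  obtain N j where I: "I = dyadic_interval N j" "N \<ge> 1"
    using assms by (auto simp: dyadic_intervals_def)
  \<comment> \<open>Because of the shift by one in the indexing, halving acts on
    \<open>j - 1\<close>.\<close>
  let ?J = "dyadic_interval (Suc N) ((j - 1) div 2 + 1)"
  have "?J \<in> dyadic_intervals"
    unfolding dyadic_intervals_def by auto
  moreover have card: "card ?J = 2 * card I"
    by (simp add: I card_dyadic_interval)
  moreover have "I \<subseteq> ?J"
  proof
    fix m
    assume "m \<in> I"
    then have "(m - 1) div 2 ^ N = j - 1"
      by (simp add: I mem_dyadic_interval_iff)
    moreover have "(m - 1) div 2 ^ Suc N = (m - 1) div 2 ^ N div 2"
      using zdiv_zmult2_eq[of 2 "m - 1" "2 ^ N"] by (simp add: mult.commute)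
    ultimately show "m \<in> ?J"
      unfolding mem_dyadic_interval_iff by linarith
  qed
  moreover have "I \<noteq> ?J"
    using card card_dyadic_interval[of N j] by (auto simp: I)
  ultimately show ?thesis
    using that by blast
qed

lemma finite_dyadic: "I \<in> dyadic_intervals \<Longrightarrow> finite I"
  by (auto simp: dyadic_intervals_def dyadic_interval_def)

lemma card_dyadic_pos: "I \<in> dyadic_intervals \<Longrightarrow> card I > 0"
  by (auto simp: dyadic_intervals_def card_dyadic_interval)

text \<open>This allows the sharp maximal function to be tested on dyadic parents.\<close>

lemma dyadic_subset_intervals: "dyadic_intervals \<subseteq> intervals"
proof
  fix I
  assume "I \<in> dyadic_intervals"
  moreover have "(j - 1) * 2 ^ N + 1 \<le> j * 2 ^ N" for j :: int and N
    using zero_less_power[of "2 :: int" N] by (simp add: left_diff_distrib)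
  ultimately show "I \<in> intervals"
    unfolding dyadic_intervals_def intervals_def dyadic_interval_def by blast
qed

section \<open>Oscillation bounds and stopping intervals\<close>

lemma sharp_maximal_upper:
  assumes "p > 0" "in_lp p a" "I \<in> intervals" "m \<in> I"
  shows "(\<Sum>n\<in>I. \<bar>a n - avg a I\<bar>) / real (card I) \<le> sharp_maximal a m"
  unfolding sharp_maximal_def using assms by (intro cSUP_upper bdd_above_sharp) auto

text \<open>The Calderon-Zygmund intervals of \<open>a\<close> at height \<open>t\<close>.
  Maximality is phrased through the means of all larger dyadic intervals, so the bound for the
  parent can be read off.\<close>

definition stopping_intervals :: "(int \<Rightarrow> real) \<Rightarrow> real \<Rightarrow> int set set" where
  "stopping_intervals a t =
     {Q \<in> dyadic_intervals. t < avg a Q \<and> (\<forall>I\<in>dyadic_intervals. Q \<subset> I \<longrightarrow> avg a I \<le> t)}"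

lemma stopping_intervals_eq:
  assumes "Q \<in> stopping_intervals a t" "I \<in> dyadic_intervals" "t < avg a I" "Q \<subseteq> I"
  shows "I = Q"
  using assms unfolding stopping_intervals_def by force

text \<open>Dyadic intervals that meet are nested, and by maximality nested stopping intervals
  coincide.\<close>

lemma disjoint_stopping_intervals:
  assumes "Q \<in> stopping_intervals a t" "R \<in> stopping_intervals a t" "Q \<noteq> R"
  shows "Q \<inter> R = {}"
proof (rule ccontr)
  assume "Q \<inter> R \<noteq> {}"
  moreover have "Q \<in> dyadic_intervals" "R \<in> dyadic_intervals" "t < avg a Q" "t < avg a R"
    using assms by (auto simp: stopping_intervals_def)
  ultimately show False
    using dyadic_intervals_laminar stopping_intervals_eq assms by (metis disjoint_iff)
qed

section \<open>Level sets of the dyadic maximal function of a nonnegative sequence\<close>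

context
  fixes p :: real and a :: "int \<Rightarrow> real"
  assumes p: "p > 0" and lp: "in_lp p a" and nonneg: "\<And>n. a n \<ge> 0"
begin

text \<open>\<open>in_lp\<close> bounds the averages, so the real supremum is a genuine one;
  nonnegativity identifies the averages of absolute values with \<open>avg\<close>.\<close>

lemma less_dyadic_maximal_iff:
  "t < dyadic_maximal a m \<longleftrightarrow> (\<exists>I\<in>dyadic_intervals. m \<in> I \<and> t < avg a I)"
proof -
  have "t < dyadic_maximal a m \<longleftrightarrow>
      (\<exists>I\<in>{I \<in> dyadic_intervals. m \<in> I}. t < (\<Sum>k\<in>I. \<bar>a k\<bar>) / real (card I))"
    unfolding dyadic_maximal_def using dyadic_intervals_cover
    by (intro less_cSUP_iff bdd_above_dyadic[OF p lp]) auto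
  then show ?thesis
    using nonneg by (auto simp: avg_def)
qed

lemma dyadic_maximal_nonneg: "dyadic_maximal a m \<ge> 0"
proof (rule ccontr)
  assume "\<not> dyadic_maximal a m \<ge> 0"
  moreover obtain I where "I \<in> dyadic_intervals" "m \<in> I"
    using dyadic_intervals_cover by blast
  moreover have "avg a I \<ge> 0"
    unfolding avg_def using nonneg by (simp add: sum_nonneg)
  ultimately show False
    using less_dyadic_maximal_iff[of "dyadic_maximal a m" m] by force
qed

lemma sharp_maximal_nonneg: "sharp_maximal a m \<ge> 0"
proof -
  \<comment> \<open>The oscillation over a singleton is zero.\<close>
  have "{m} \<in> intervals"
    by (auto simp: intervals_def intro!: exI[of _ m])
  then show ?thesis
    using sharp_maximal_upper[OF p lp, of "{m}" m] by (simp add: avg_def)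
qed

lemma subset_dyadic_level:
  "I \<in> dyadic_intervals \<Longrightarrow> t < avg a I \<Longrightarrow> I \<subseteq> {m. t < dyadic_maximal a m}"
  using less_dyadic_maximal_iff by auto

text \<open>Every dyadic interval of mean above \<open>t\<close> lies in the level set. A finite
  level set has finitely many subsets, so each such interval is contained in a maximal one.\<close>

lemma Union_stopping_intervals:
  assumes fin: "finite {m. t < dyadic_maximal a m}"
  shows "\<Union> (stopping_intervals a t) = {m. t < dyadic_maximal a m}"
proof
  show "\<Union> (stopping_intervals a t) \<subseteq> {m. t < dyadic_maximal a m}"
    using subset_dyadic_level by (force simp: stopping_intervals_def)
  show "{m. t < dyadic_maximal a m} \<subseteq> \<Union> (stopping_intervals a t)"
  proof
    fix m
    assume "m \<in> {m. t < dyadic_maximal a m}"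
    then obtain I where I: "I \<in> dyadic_intervals" "m \<in> I" "t < avg a I"
      using less_dyadic_maximal_iff by auto
    let ?A = "{J \<in> dyadic_intervals. t < avg a J}"
    have "?A \<subseteq> Pow {m. t < dyadic_maximal a m}"
      using subset_dyadic_level by auto
    then have "finite ?A"
      using fin by (meson finite_Pow_iff finite_subset)
    moreover have "I \<in> ?A" using I by simp
    ultimately have "\<exists>Q\<in>?A. I \<subseteq> Q \<and> (\<forall>J\<in>?A. Q \<subseteq> J \<longrightarrow> Q = J)"
      by (rule finite_has_maximal2)
    then obtain Q where Q: "Q \<in> ?A" "I \<subseteq> Q" and max: "\<forall>J\<in>?A. Q \<subseteq> J \<longrightarrow> Q = J"
      by blast
    have "avg a J \<le> t" if "J \<in> dyadic_intervals" "Q \<subset> J" for J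
      using max that by (rule_tac ccontr) auto
    then have "Q \<in> stopping_intervals a t"
      using Q unfolding stopping_intervals_def by blast
    moreover have "m \<in> Q"
      using I Q by blast
    ultimately show "m \<in> \<Union> (stopping_intervals a t)" by blast
  qed
qed

lemma finite_stopping_intervals:
  assumes "finite {m. t < dyadic_maximal a m}"
  shows "finite (stopping_intervals a t)"
  using Union_stopping_intervals[OF assms] assms by (metis finite_UnionD)

text \<open>The part of the higher level set inside \<open>Q\<close> forces oscillation of
  \<open>a\<close> over the parent of \<open>Q\<close>. The parent contains every \<open>x\<close>
  in \<open>Q\<close>, so the sharp maximal function at any single point of \<open>Q\<close> bounds
  the whole count.\<close>

lemma card_level_in_stopping_interval:
  assumes t: "t > 0" and fin: "finite {m. t < dyadic_maximal a m}"
    and Q: "Q \<in> stopping_intervals a t" and x: "x \<in> Q"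
  shows "t * real (card ({m. 2 * t < dyadic_maximal a m} \<inter> Q)) \<le>
    2 * real (card Q) * sharp_maximal a x"
proof -
  let ?F = "{J \<in> stopping_intervals a (2 * t). J \<subseteq> Q}"
  have dyadic_Q: "Q \<in> dyadic_intervals" and avg_Q: "t < avg a Q"
    using Q by (auto simp: stopping_intervals_def)
  obtain P where P: "P \<in> dyadic_intervals" "Q \<subset> P" "card P = 2 * card Q"
    using dyadic_parent[OF dyadic_Q] .
  have avg_P: "avg a P \<le> t"
    using Q P by (auto simp: stopping_intervals_def)
  have fin2: "finite {m. 2 * t < dyadic_maximal a m}"
    using fin t by (rule_tac finite_subset) auto
  have dyadic_F: "J \<in> dyadic_intervals" "2 * t < avg a J" if "J \<in> ?F" for J
    using that by (auto simp: stopping_intervals_def)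
  \<comment> \<open>A stopping interval at height \<open>2 * t\<close> that meets \<open>Q\<close>
    cannot properly contain it: its mean exceeds \<open>t\<close>, against the maximality of
    \<open>Q\<close>.\<close>
  have level: "{m. 2 * t < dyadic_maximal a m} \<inter> Q = \<Union>?F"
  proof (intro equalityI subsetI)
    fix m
    assume m: "m \<in> {m. 2 * t < dyadic_maximal a m} \<inter> Q"
    then obtain J where J: "J \<in> stopping_intervals a (2 * t)" "m \<in> J"
      using Union_stopping_intervals[OF fin2] by blast
    then have dyadic_J: "J \<in> dyadic_intervals" and "t < avg a J"
      using t by (auto simp: stopping_intervals_def)
    then have "J = Q" if "Q \<subseteq> J"
      using stopping_intervals_eq[OF Q] that by simp
    moreover have "J \<subseteq> Q \<or> Q \<subseteq> J"
      using m J by (intro dyadic_intervals_laminar[OF dyadic_J dyadic_Q, of m]) auto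
    ultimately have "J \<subseteq> Q" by blast
    then show "m \<in> \<Union>?F" using J by blast
  qed (use Union_stopping_intervals[OF fin2] in blast)
  have disj: "\<forall>I\<in>?F. \<forall>J\<in>?F. I \<noteq> J \<longrightarrow> I \<inter> J = {}"
    using disjoint_stopping_intervals by blast
  \<comment> \<open>The mean over \<open>J\<close> exceeds \<open>2 * t\<close> and the mean over
    \<open>P\<close> is at most \<open>t\<close>; the gap of \<open>t\<close> is
    oscillation.\<close>
  have "t * real (card J) \<le> (\<Sum>n\<in>J. \<bar>a n - avg a P\<bar>)" if "J \<in> ?F" for J
  proof -
    have "2 * t * real (card J) \<le> (\<Sum>n\<in>J. a n)"
      using dyadic_F[OF that] card_dyadic_pos[of J] by (simp add: avg_def pos_less_divide_eq)
    moreover have "real (card J) * avg a P \<le> t * real (card J)"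
      using avg_P by (simp add: mult.commute mult_right_mono)
    moreover have "(\<Sum>n\<in>J. a n) - real (card J) * avg a P = (\<Sum>n\<in>J. a n - avg a P)"
      by (simp add: sum_subtractf)
    moreover have "\<dots> \<le> (\<Sum>n\<in>J. \<bar>a n - avg a P\<bar>)"
      by (intro sum_mono) auto
    ultimately show ?thesis by linarith
  qed
  then have "(\<Sum>J\<in>?F. t * real (card J)) \<le> (\<Sum>J\<in>?F. \<Sum>n\<in>J. \<bar>a n - avg a P\<bar>)"
    by (rule sum_mono)
  also have "\<dots> = (\<Sum>n\<in>\<Union>?F. \<bar>a n - avg a P\<bar>)"
    using dyadic_F finite_dyadic disj
    by (subst sum.Union_disjoint[of ?F]) (auto simp only: o_def)
  also have "\<dots> \<le> (\<Sum>n\<in>P. \<bar>a n - avg a P\<bar>)"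
    using P finite_dyadic by (intro sum_mono2) auto
  \<comment> \<open>\<open>P\<close> is admissible in the supremum at \<open>x\<close>; its size,
    twice that of \<open>Q\<close>, produces the factor 2.\<close>
  also have "\<dots> \<le> real (card P) * sharp_maximal a x"
    using sharp_maximal_upper[OF p lp subsetD[OF dyadic_subset_intervals P(1)], of x] P x
      card_dyadic_pos[OF P(1)]
    by (auto simp: pos_divide_le_eq mult.commute)
  finally have "(\<Sum>J\<in>?F. t * real (card J)) \<le> 2 * real (card Q) * sharp_maximal a x"
    by (simp add: P)
  moreover have "card (\<Union>?F) = (\<Sum>J\<in>?F. card J)"
    using dyadic_F finite_dyadic disj by (intro card_Union_disjoint) (auto simp: pairwise_def disjnt_def)
  ultimately show ?thesis
    unfolding level by (simp add: sum_distrib_left)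
qed

text \<open>If the exceptional set meets a stopping interval \<open>Q\<close>, one common point
  supplies the sharp bound for all of \<open>Q\<close>, and the local estimate limits the set to a
  fraction \<open>2 * \<gamma>\<close> of \<open>Q\<close>. Disjointness lets these fractions be
  summed.\<close>

lemma card_dyadic_level_good:
  assumes t: "t > 0" and "\<gamma> \<ge> 0" and fin: "finite {m. t < dyadic_maximal a m}"
  shows "real (card {m. 2 * t < dyadic_maximal a m \<and> sharp_maximal a m \<le> \<gamma> * t}) \<le>
    2 * \<gamma> * real (card {m. t < dyadic_maximal a m})"
proof -
  let ?S = "stopping_intervals a t"
  let ?E = "{m. 2 * t < dyadic_maximal a m \<and> sharp_maximal a m \<le> \<gamma> * t}"
  have dyadic: "Q \<in> dyadic_intervals" if "Q \<in> ?S" for Q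
    using that by (simp add: stopping_intervals_def)
  have local_bound: "real (card (?E \<inter> Q)) \<le> 2 * \<gamma> * real (card Q)" if Q: "Q \<in> ?S" for Q
  proof (cases "?E \<inter> Q = {}")
    case False
    then obtain x where x: "x \<in> Q" "sharp_maximal a x \<le> \<gamma> * t" by blast
    have "t * real (card (?E \<inter> Q)) \<le> t * real (card ({m. 2 * t < dyadic_maximal a m} \<inter> Q))"
      using t finite_dyadic[OF dyadic[OF Q]] by (intro mult_left_mono of_nat_mono card_mono) auto
    also have "\<dots> \<le> 2 * real (card Q) * sharp_maximal a x"
      using card_level_in_stopping_interval[OF t fin Q x(1)] .
    also have "\<dots> \<le> 2 * real (card Q) * (\<gamma> * t)"
      using x(2) by (intro mult_left_mono) auto
    finally have "t * real (card (?E \<inter> Q)) \<le> t * (2 * \<gamma> * real (card Q))"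
      by (simp add: algebra_simps)
    then show ?thesis using t by simp
  qed (use assms in simp)
  have "?E \<subseteq> {m. t < dyadic_maximal a m}" using t by auto
  then have "?E = ?E \<inter> \<Union>?S"
    unfolding Union_stopping_intervals[OF fin] by (rule Int_absorb2[symmetric])
  then have "?E = (\<Union>Q\<in>?S. ?E \<inter> Q)"
    by (simp only: Int_Union)
  then have "real (card ?E) \<le> (\<Sum>Q\<in>?S. real (card (?E \<inter> Q)))"
    using card_UN_le[OF finite_stopping_intervals[OF fin], of "\<lambda>Q. ?E \<inter> Q"]
    unfolding of_nat_sum[symmetric] of_nat_le_iff by metis
  also have "\<dots> \<le> (\<Sum>Q\<in>?S. 2 * \<gamma> * real (card Q))"
    by (rule sum_mono[OF local_bound])
  also have "\<dots> = 2 * \<gamma> * real (card (\<Union>?S))"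
    using disjoint_stopping_intervals dyadic finite_dyadic
    by (subst card_Union_disjoint) (auto simp: pairwise_def disjnt_def sum_distrib_left)
  finally show ?thesis
    by (simp add: Union_stopping_intervals[OF fin])
qed

text \<open>Chebyshev's inequality for counting measure: an infinite level set at positive height
  would make the integral infinite.\<close>

lemma finite_dyadic_level:
  assumes t: "t > 0"
    and finite: "(\<integral>\<^sup>+m. ennreal (dyadic_maximal a m powr p) \<partial>count_space UNIV) < \<infinity>"
  shows "finite {m. t < dyadic_maximal a m}"
proof -
  let ?E = "{m. t < dyadic_maximal a m}"
  have "ennreal (t powr p) * emeasure (count_space UNIV) ?E =
      (\<integral>\<^sup>+m. ennreal (t powr p) * indicator ?E m \<partial>count_space UNIV)"
    by (subst nn_integral_cmult_indicator) auto
  also have "\<dots> \<le> (\<integral>\<^sup>+m. ennreal (dyadic_maximal a m powr p) \<partial>count_space UNIV)"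
    using t p by (intro nn_integral_mono) (auto intro!: ennreal_leI powr_mono2 split: split_indicator)
  finally have "ennreal (t powr p) * emeasure (count_space UNIV) ?E < \<infinity>"
    using finite by (rule le_less_trans)
  then show ?thesis
    using t by (auto simp: emeasure_count_space ennreal_mult_top split: if_splits)
qed

end

section \<open>Choice of the parameters and application to counting measure on the integers\<close>

theorem theorem4p7:
  fixes p :: real
  assumes "1 < p"
  shows "\<exists>C::real. C > 0 \<and>
    (\<forall>a :: int \<Rightarrow> real.
      (\<forall>n. a n \<ge> 0) \<longrightarrow> in_lp p a \<longrightarrow>
      (\<Sum>\<^sub>\<infinity>m\<in>UNIV. ennreal (\<bar>dyadic_maximal a m\<bar> powr p)) < \<infinity> \<longrightarrow>
      (\<Sum>\<^sub>\<infinity>m\<in>UNIV. ennreal (\<bar>dyadic_maximal a m\<bar> powr p))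
        \<le> ennreal C * (\<Sum>\<^sub>\<infinity>m\<in>UNIV. ennreal (\<bar>sharp_maximal a m\<bar> powr p)))"
proof -
  have p: "p > 0" using assms by simp
  \<comment> \<open>With \<epsilon> equal to \<open>2 * \<gamma>\<close>, this makes
    \<open>2 powr p * \<epsilon>\<close> exactly 1/2.\<close>
  define \<gamma> :: real where "\<gamma> = 2 powr (- p) / 4"
  have \<gamma>: "\<gamma> > 0" by (simp add: \<gamma>_def)
  \<comment> \<open>In order: the lower layer comparison, the absorption, the upper layer
    comparison, and the rescaling of the sharp function by \<gamma>.\<close>
  define C where "C = 2 powr p * (2 * 2 powr p * (1 / (1 - 2 powr (- p)) * (1 / \<gamma>) powr p))"
  have "C > 0"
    using p \<gamma> powr_less_mono[of "- p" 0 2] by (simp add: C_def)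
  moreover have "(\<Sum>\<^sub>\<infinity>m\<in>UNIV. ennreal (\<bar>dyadic_maximal a m\<bar> powr p))
        \<le> ennreal C * (\<Sum>\<^sub>\<infinity>m\<in>UNIV. ennreal (\<bar>sharp_maximal a m\<bar> powr p))"
    if nonneg: "\<forall>n. a n \<ge> 0" and lp: "in_lp p a"
      and fin: "(\<Sum>\<^sub>\<infinity>m\<in>UNIV. ennreal (\<bar>dyadic_maximal a m\<bar> powr p)) < \<infinity>" for a
  proof -
    note facts = p lp nonneg[rule_format]
    note max_nonneg = dyadic_maximal_nonneg[OF facts] sharp_maximal_nonneg[OF facts]
    have finite: "(\<integral>\<^sup>+m. ennreal (dyadic_maximal a m powr p) \<partial>count_space UNIV) < \<infinity>"
      using fin by (simp add: infsum_int_ennreal_eq_nn_integral max_nonneg)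
    have "(\<integral>\<^sup>+m. ennreal (dyadic_maximal a m powr p) \<partial>count_space UNIV) \<le>
        ennreal C * (\<integral>\<^sup>+m. ennreal (sharp_maximal a m powr p) \<partial>count_space UNIV)"
      unfolding C_def
    proof (rule nn_integral_good_lambda[where \<epsilon> = "2 * \<gamma>"])
      show "2 powr p * (2 * \<gamma>) \<le> 1 / 2"
        by (simp add: \<gamma>_def powr_minus)
      fix t :: real
      assume t: "t > 0"
      let ?\<mu> = "emeasure (count_space (UNIV :: int set))"
      let ?E = "\<lambda>t. {m. t < dyadic_maximal a m}" and ?G = "{m. \<gamma> * t < sharp_maximal a m}"
      let ?H = "{m. 2 * t < dyadic_maximal a m \<and> sharp_maximal a m \<le> \<gamma> * t}"
      have fin_E: "finite (?E t)"
        using finite_dyadic_level[OF facts t finite] .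
      then have fin_H: "finite ?H"
        using t by (rule_tac finite_subset) auto
      \<comment> \<open>Points of the higher level set are split by the size of the sharp function;
        only \<open>?H\<close> needs the counting estimate.\<close>
      have "?\<mu> (?E (2 * t)) \<le> ?\<mu> (?H \<union> ?G)"
        by (intro emeasure_mono) auto
      also have "\<dots> \<le> ?\<mu> ?H + ?\<mu> ?G"
        by (intro emeasure_subadditive) auto
      also have "?\<mu> ?H \<le> ennreal (2 * \<gamma>) * ?\<mu> (?E t)"
        using card_dyadic_level_good[OF facts t _ fin_E, of \<gamma>] \<gamma> fin_E fin_H
        by (simp add: ennreal_of_nat_eq_real_of_nat ennreal_mult[symmetric] ennreal_leI)
      finally show "?\<mu> {m \<in> space (count_space UNIV). 2 * t < dyadic_maximal a m} \<le>
          ennreal (2 * \<gamma>) * ?\<mu> {m \<in> space (count_space UNIV). t < dyadic_maximal a m} +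
          ?\<mu> {m \<in> space (count_space UNIV). \<gamma> * t < sharp_maximal a m}"
        by (simp add: add_right_mono)
    qed (use p \<gamma> finite max_nonneg in simp_all)
    then show ?thesis
      by (simp add: infsum_int_ennreal_eq_nn_integral max_nonneg)
  qed
  ultimately show ?thesis by blast
qed

end
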